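(* For any consistent envy-free pricing mechanism $A$ and any market with $n$ buyers, the best response dynamic starting from the truth-telling profile converges to a pure Nash equilibrium of $A$ in at most $n$ steps.
   Context: Market: a linear multi-unit market $\mathcal{M}=(\mathbf{v},\mathbf{B},m)$ has buyers $N=\{1,\dots,n\}$ and one seller with $m$ indivisible identical units. Buyer $i$ has budget $B_i>0$ and per-unit valuation $v_i$. The utility of buyer $i$ for $k$ units at unit price $p$ is $u_i(p,k)=v_ik-pk$ if $pk\le B_i$ and $-\infty$ otherwise. The demand set $D_i(p)$ is $\{\min\{\lfloor B_i/p\rfloor,m\}\}$ if $v_i>p$ (buyer $i$ is hungry at $p$); $\{0,1,\dots,\min\{\lfloor B_i/p\rfloor,m\}\}$ if $v_i=p$ (semi-hungry); and $\{0\}$ if $v_i<p$ (uninterested). An outcome $(\mathbf{x},p)$ with $x_i\in\mathbb{Z}_{\ge 0}$ and $\sum_i x_i\le m$ is an envy-free pricing if $x_i\in D_i(p)$ for all $i$; price $0$ is not regarded as an envy-free price. Discrete domain: valuations, reports and budgets lie in $\mathbb{V}=\{k\epsilon: k\in\mathbb{N}\}$ for some fixed $\epsilon>0$, and prices are chosen from $\mathbb{W}=\{k\delta:k\in\mathbb{N}\}$ for some fixed $\delta>0$. Mechanism: an envy-free pricing mechanism $A$ maps each market (reported valuations, known budgets $\mathbf{B}$, known $m$) to an envy-free pricing $(\mathbf{x},p)$ with respect to the reported valuations. A strategy of buyer $i$ is a reported valuation $s_i\in\mathbb{V}$. Buyer $i$'s utility at a profile $\mathbf{s}$ is computed with its true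 valuation $v_i$ and the outcome of $A$ on $\mathbf{s}$. A profile is a pure Nash equilibrium if no buyer can strictly improve its utility by changing its own report. Consistent: $A$ is consistent if the following holds. Let $\mathcal{M}=(\mathbf{v},\mathbf{B},m)$ be any market on which $A$ outputs price $p$ and allocation $\mathbf{x}$. Then for every market $\mathcal{M}'=(\mathbf{v}',\mathbf{B},m)$ for which the sets of hungry and semi-hungry buyers at $p$ are the same as in $\mathcal{M}$, $A$ outputs $(p,\mathbf{x})$ as well. Best response dynamic: starting from an initial profile, at each step some buyer (in arbitrary order) who can strictly improve its utility changes its report to one maximizing its utility given the current reports of the others. The dynamic converges when no buyer can strictly improve. *)

theory Defs
  imports "HOL-Library.Extended_Real" "HOL-Library.Cardinality"
begin

text \<open>Buyers are the elements of a finite type, so the number of buyers is the cardinality of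
  that type.\<close>

record 'i market =
  val :: "'i \<Rightarrow> real"
  budget :: "'i \<Rightarrow> real"
  units :: nat

type_synonym 'i outcome = "('i \<Rightarrow> nat) \<times> real"
type_synonym 'i mechanism = "'i market \<Rightarrow> 'i outcome"

definition grid :: "real \<Rightarrow> real set" where
  "grid \<epsilon> = {real k * \<epsilon> | k. True}"

definition is_market :: "real \<Rightarrow> 'i market \<Rightarrow> bool" where
  "is_market \<epsilon> M \<longleftrightarrow>
     (\<forall>i. val M i \<in> grid \<epsilon>) \<and> (\<forall>i. budget M i \<in> grid \<epsilon> \<and> budget M i > 0)"

definition utility :: "real \<Rightarrow> real \<Rightarrow> real \<Rightarrow> nat \<Rightarrow> ereal" where
  "utility v b p k = (if p * real k \<le> b then ereal (v * real k - p * real k) else - \<infinity>)"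

definition hungry :: "'i market \<Rightarrow> real \<Rightarrow> 'i set" where
  "hungry M p = {i. val M i > p}"

definition semi_hungry :: "'i market \<Rightarrow> real \<Rightarrow> 'i set" where
  "semi_hungry M p = {i. val M i = p}"

text \<open>Only used at prices \<open>p > 0\<close>, where the floor is nonnegative because budgets are.\<close>

definition max_units :: "'i market \<Rightarrow> real \<Rightarrow> 'i \<Rightarrow> nat" where
  "max_units M p i = min (nat \<lfloor>budget M i / p\<rfloor>) (units M)"

definition demand :: "'i market \<Rightarrow> real \<Rightarrow> 'i \<Rightarrow> nat set" where
  "demand M p i =
     (if i \<in> hungry M p then {max_units M p i}
      else if i \<in> semi_hungry M p then {0..max_units M p i}
      else {0})"

definition envy_free_pricing :: "'i::finite market \<Rightarrow> 'i outcome \<Rightarrow> bool" where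
  "envy_free_pricing M = (\<lambda>(x, p).
     p > 0 \<and> (\<Sum>i\<in>UNIV. x i) \<le> units M \<and> (\<forall>i. x i \<in> demand M p i))"

definition envy_free_mechanism :: "real \<Rightarrow> real \<Rightarrow> 'i::finite mechanism \<Rightarrow> bool" where
  "envy_free_mechanism \<epsilon> \<delta> A \<longleftrightarrow>
     (\<forall>M. is_market \<epsilon> M \<longrightarrow> snd (A M) \<in> grid \<delta> \<and> envy_free_pricing M (A M))"

definition consistent :: "real \<Rightarrow> 'i mechanism \<Rightarrow> bool" where
  "consistent \<epsilon> A \<longleftrightarrow>
     (\<forall>M M' x p. is_market \<epsilon> M \<and> is_market \<epsilon> M' \<and> A M = (x, p) \<and>
        budget M' = budget M \<and> units M' = units M \<and>
        hungry M' p = hungry M p \<and> semi_hungry M' p = semi_hungry M p \<longrightarrow>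
        A M' = (x, p))"

text \<open>In the game below, \<open>M\<close> is the true market: the mechanism is run on the reports \<open>s\<close>, while
  the outcome is evaluated with the valuations of \<open>M\<close>.\<close>

definition payoff :: "'i mechanism \<Rightarrow> 'i market \<Rightarrow> ('i \<Rightarrow> real) \<Rightarrow> 'i \<Rightarrow> ereal" where
  "payoff A M s i =
     (case A (M\<lparr>val := s\<rparr>) of (x, p) \<Rightarrow> utility (val M i) (budget M i) p (x i))"

definition can_improve ::
    "real \<Rightarrow> 'i mechanism \<Rightarrow> 'i market \<Rightarrow> ('i \<Rightarrow> real) \<Rightarrow> 'i \<Rightarrow> bool" where
  "can_improve \<epsilon> A M s i \<longleftrightarrow> (\<exists>r \<in> grid \<epsilon>. payoff A M (s(i := r)) i > payoff A M s i)"

definition pure_nash :: "real \<Rightarrow> 'i mechanism \<Rightarrow> 'i market \<Rightarrow> ('i \<Rightarrow> real) \<Rightarrow> bool" where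
  "pure_nash \<epsilon> A M s \<longleftrightarrow> (\<forall>i. s i \<in> grid \<epsilon>) \<and> (\<forall>i. \<not> can_improve \<epsilon> A M s i)"

definition best_response ::
    "real \<Rightarrow> 'i mechanism \<Rightarrow> 'i market \<Rightarrow> ('i \<Rightarrow> real) \<Rightarrow> 'i \<Rightarrow> real \<Rightarrow> bool" where
  "best_response \<epsilon> A M s i r \<longleftrightarrow>
     r \<in> grid \<epsilon> \<and> (\<forall>r' \<in> grid \<epsilon>. payoff A M (s(i := r')) i \<le> payoff A M (s(i := r)) i)"

definition br_step ::
    "real \<Rightarrow> 'i mechanism \<Rightarrow> 'i market \<Rightarrow> ('i \<Rightarrow> real) \<Rightarrow> ('i \<Rightarrow> real) \<Rightarrow> bool" where
  "br_step \<epsilon> A M s s' \<longleftrightarrow>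
     (\<exists>i r. can_improve \<epsilon> A M s i \<and> best_response \<epsilon> A M s i r \<and> s' = s(i := r))"

text \<open>Quantifying over all step sequences covers every order of the buyers and every choice
  among several best responses. The second conjunct says that a sequence can only get stuck at an
  equilibrium; in particular, it rules out getting stuck because a supremum of payoffs is not
  attained. By the first conjunct, every sequence gets stuck after at most \<open>n\<close> steps.\<close>

definition br_converges_within ::
    "real \<Rightarrow> 'i mechanism \<Rightarrow> 'i market \<Rightarrow> ('i \<Rightarrow> real) \<Rightarrow> nat \<Rightarrow> bool" where
  "br_converges_within \<epsilon> A M s\<^sub>0 n \<longleftrightarrow>
     (\<forall>k s. (br_step \<epsilon> A M ^^ k) s\<^sub>0 s \<longrightarrow>
        k \<le> n \<and> ((\<nexists>s'. br_step \<epsilon> A M s s') \<longrightarrow> pure_nash \<epsilon> A M s))"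

end

theory Submission
  imports Defs
begin

text \<open>The utility of a buyer at an envy-free price \<open>p\<close> is at most its utility from a favourite
  affordable bundle at \<open>p\<close>, which decreases in \<open>p\<close>; a truthful buyer attains this bound. So a truthful
  buyer \<open>j\<close> can only gain by lowering the price to some \<open>p' < v\<^sub>j\<close> at which it still buys. A report
  above \<open>p'\<close> would by consistency be equivalent to the truth, hence \<open>j\<close> reports exactly \<open>p'\<close>. After
  such a step, every buyer \<open>i\<close> that deviated earlier is hungry at the new price, both for its
  report and for its true value. A further gain for \<open>i\<close> would need a price below \<open>p'\<close>, where the
  reports \<open>p'\<close> and \<open>v\<^sub>j\<close> of \<open>j\<close> are equivalent, so \<open>i\<close> could already have gained before the step of
  \<open>j\<close>. Thus every buyer moves at most once.\<close>

section \<open>Bounds on the grid, on demand and on affordable bundles\<close>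

lemma finite_grid_less:
  assumes "\<epsilon> > 0"
  shows "finite {r \<in> grid \<epsilon>. r < b}"
proof (rule finite_subset)
  show "{r \<in> grid \<epsilon>. r < b} \<subseteq> (\<lambda>k. real k * \<epsilon>) ` {..nat \<lceil>b / \<epsilon>\<rceil>}"
  proof
    fix r assume "r \<in> {r \<in> grid \<epsilon>. r < b}"
    then obtain k where k: "r = real k * \<epsilon>" "real k * \<epsilon> < b"
      by (auto simp: grid_def)
    then have "real k < b / \<epsilon>"
      using assms by (simp add: field_simps)
    then have "k \<le> nat \<lceil>b / \<epsilon>\<rceil>" by linarith
    with k show "r \<in> (\<lambda>k. real k * \<epsilon>) ` {..nat \<lceil>b / \<epsilon>\<rceil>}" by blast
  qed
qed simp

lemma demand_le_max_units: "k \<in> demand M p i \<Longrightarrow> k \<le> max_units M p i"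
  by (auto simp: demand_def split: if_splits)

lemma max_units_affordable:
  assumes "p > 0" "budget M i > 0" "k \<le> max_units M p i"
  shows "p * real k \<le> budget M i"
proof -
  have "real k \<le> real (nat \<lfloor>budget M i / p\<rfloor>)"
    using assms(3) by (simp add: max_units_def)
  also have "\<dots> \<le> budget M i / p"
    using assms(1,2) by (simp add: of_nat_nat)
  finally show ?thesis
    using assms(1) by (simp add: field_simps)
qed

lemma max_units_antimono:
  assumes "0 < p" "p \<le> q" "budget M i > 0"
  shows "max_units M q i \<le> max_units M p i"
proof -
  have "budget M i / q \<le> budget M i / p"
    using assms by (intro divide_left_mono) auto
  then show ?thesis
    unfolding max_units_def by (intro min.mono nat_mono floor_mono) auto
qed

text \<open>For \<open>p > 0\<close>, the largest utility over affordable bundles of at most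
  \<open>units M\<close> units; \<open>max 0\<close> stands for buying nothing once \<open>p\<close>
  exceeds the value.\<close>

definition surplus :: "'i market \<Rightarrow> 'i \<Rightarrow> real \<Rightarrow> real" where
  "surplus M i p = max 0 (val M i - p) * real (max_units M p i)"

lemma surplus_nonneg: "0 \<le> surplus M i p"
  by (simp add: surplus_def)

lemma surplus_antimono:
  assumes "0 < p" "p \<le> q" "budget M i > 0"
  shows "surplus M i q \<le> surplus M i p"
  unfolding surplus_def using max_units_antimono[OF assms] assms(2)
  by (intro mult_mono) auto

section \<open>Prices, allocations and payoffs at a profile of reports\<close>

locale consistent_market =
  fixes \<epsilon> \<delta> :: real and A :: "'i::finite mechanism" and M :: "'i market"
  assumes eps_pos: "\<epsilon> > 0"
    and envy_free: "envy_free_mechanism \<epsilon> \<delta> A"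
    and cons: "consistent \<epsilon> A"
    and market: "is_market \<epsilon> M"
begin

definition valid_reports :: "('i \<Rightarrow> real) \<Rightarrow> bool" where
  "valid_reports s \<longleftrightarrow> (\<forall>i. s i \<in> grid \<epsilon>)"

lemma valid_reports_upd: "valid_reports s \<Longrightarrow> r \<in> grid \<epsilon> \<Longrightarrow> valid_reports (s(i := r))"
  by (simp add: valid_reports_def)

lemma valid_reportsD: "valid_reports s \<Longrightarrow> s i \<in> grid \<epsilon>"
  by (simp add: valid_reports_def)

definition price :: "('i \<Rightarrow> real) \<Rightarrow> real" where
  "price s = snd (A (M\<lparr>val := s\<rparr>))"

definition alloc :: "('i \<Rightarrow> real) \<Rightarrow> 'i \<Rightarrow> nat" where
  "alloc s = fst (A (M\<lparr>val := s\<rparr>))"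

lemma budget_pos: "budget M i > 0"
  using market by (simp add: is_market_def)

lemma valid_val: "valid_reports (val M)"
  using market by (simp add: is_market_def valid_reports_def)

lemma is_market_reports: "valid_reports s \<Longrightarrow> is_market \<epsilon> (M\<lparr>val := s\<rparr>)"
  using market by (simp add: is_market_def valid_reports_def)

lemma
  assumes "valid_reports s"
  shows price_pos: "price s > 0"
    and alloc_demand: "alloc s i \<in> demand (M\<lparr>val := s\<rparr>) (price s) i"
proof -
  have "envy_free_pricing (M\<lparr>val := s\<rparr>) (A (M\<lparr>val := s\<rparr>))"
    using envy_free is_market_reports[OF assms] unfolding envy_free_mechanism_def by blast
  then show "price s > 0" "alloc s i \<in> demand (M\<lparr>val := s\<rparr>) (price s) i"
    unfolding envy_free_pricing_def price_def alloc_def split_beta by blast+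
qed

lemma alloc_le_max_units:
  assumes "valid_reports s"
  shows "alloc s i \<le> max_units M (price s) i"
  \<comment> \<open>Reports change neither budgets nor supply, hence not
    \<open>max_units\<close>.\<close>
  using demand_le_max_units[OF alloc_demand[OF assms]] by (simp add: max_units_def)

text \<open>Envy-free bundles are affordable, so the infinite branch of \<open>utility\<close> never
  occurs.\<close>

lemma payoff_eq:
  assumes "valid_reports s"
  shows "payoff A M s i = ereal ((val M i - price s) * real (alloc s i))"
  using max_units_affordable[OF price_pos[OF assms] budget_pos alloc_le_max_units[OF assms]]
  by (simp add: payoff_def utility_def price_def alloc_def split_beta algebra_simps)

lemma payoff_le_surplus:
  assumes "valid_reports s"
  shows "payoff A M s i \<le> ereal (surplus M i (price s))"
  unfolding payoff_eq[OF assms] surplus_def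
  using alloc_le_max_units[OF assms] by (auto intro!: mult_mono)

text \<open>If the price is below both report and value, the buyer receives
  \<open>max_units\<close>. If a truthful buyer's value is at most the price, it has no margin or
  receives nothing, and both sides vanish.\<close>

lemma payoff_eq_surplus:
  assumes "valid_reports s"
    and "s i = val M i \<or> price s < s i \<and> price s < val M i"
  shows "payoff A M s i = ereal (surplus M i (price s))"
  unfolding payoff_eq[OF assms(1)] surplus_def
proof -
  consider "price s < s i" "price s < val M i" | "s i = val M i" "val M i \<le> price s"
    using assms(2) by fastforce
  then show "ereal ((val M i - price s) * real (alloc s i)) =
      ereal (max 0 (val M i - price s) * real (max_units M (price s) i))"
  proof cases
    case 1
    then show ?thesis
      using alloc_demand[OF assms(1), of i]
      by (simp add: demand_def hungry_def max_units_def)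
  next
    case 2
    then show ?thesis
      using alloc_demand[OF assms(1), of i]
      by (simp add: demand_def hungry_def semi_hungry_def split: if_splits)
  qed
qed

section \<open>Consistency and single deviations\<close>

text \<open>The buyer is hungry at \<open>price s\<close> under either report, so the hungry and
  semi-hungry sets there do not change and consistency applies.\<close>

lemma outcome_upd_above_price:
  assumes "valid_reports s" "r \<in> grid \<epsilon>" "price s < s i" "price s < r"
  shows "price (s(i := r)) = price s" "alloc (s(i := r)) = alloc s"
proof -
  have v: "valid_reports (s(i := r))"
    using assms(1,2) by (rule valid_reports_upd)
  have out: "A (M\<lparr>val := s\<rparr>) = (alloc s, price s)"
    by (simp add: alloc_def price_def)
  have H: "hungry (M\<lparr>val := s(i := r)\<rparr>) (price s) = hungry (M\<lparr>val := s\<rparr>) (price s)"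
    using assms(3,4) by (auto simp: hungry_def)
  have S: "semi_hungry (M\<lparr>val := s(i := r)\<rparr>) (price s) = semi_hungry (M\<lparr>val := s\<rparr>) (price s)"
    using assms(3,4) by (auto simp: semi_hungry_def)
  have "A (M\<lparr>val := s(i := r)\<rparr>) = (alloc s, price s)"
    using cons[unfolded consistent_def, rule_format,
        of "M\<lparr>val := s\<rparr>" "M\<lparr>val := s(i := r)\<rparr>" "alloc s" "price s"]
      is_market_reports[OF assms(1)] is_market_reports[OF v] out H S
    by simp
  then show "price (s(i := r)) = price s" "alloc (s(i := r)) = alloc s"
    by (simp_all add: price_def alloc_def)
qed

lemma truthful_improvement:
  assumes s: "valid_reports s" and r: "r \<in> grid \<epsilon>" and truthful: "s j = val M j"
    and better: "payoff A M (s(j := r)) j > payoff A M s j"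
  shows "price (s(j := r)) = r" "r < price s" "r < val M j"
proof -
  let ?s = "s(j := r)"
  have s': "valid_reports ?s" using s r by (rule valid_reports_upd)
  \<comment> \<open>Truthful reporting earns the whole surplus, and no report earns more than the
    surplus at the price it leads to.\<close>
  have gain: "surplus M j (price s) < surplus M j (price ?s)"
    using order_less_le_trans[OF better payoff_le_surplus[OF s']] payoff_eq_surplus[OF s, of j]
      truthful by simp
  then have lower: "price ?s < price s"
    using surplus_antimono[OF price_pos[OF s] _ budget_pos, of "price ?s" j] by force
  have "0 < surplus M j (price ?s)"
    using gain surplus_nonneg[of M j "price s"] by simp
  then have val: "price ?s < val M j"
    by (simp add: surplus_def zero_less_mult_iff max_def split: if_splits)
  \<comment> \<open>A truthful buyer never loses, so an improvement is positive and some unit is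
    bought, which needs a report at or above the price.\<close>
  have "(0::ereal) < payoff A M ?s j"
    using payoff_eq_surplus[OF s, of j] truthful surplus_nonneg[of M j "price s"]
    by (intro order_le_less_trans[OF _ better]) simp
  then have "alloc ?s j \<noteq> 0"
    unfolding payoff_eq[OF s'] by (cases "alloc ?s j = 0") simp_all
  then have "price ?s \<le> r"
    using alloc_demand[OF s', of j]
    by (auto simp: demand_def hungry_def semi_hungry_def split: if_splits)
  moreover have "\<not> price ?s < r"
  proof
    assume "price ?s < r"
    \<comment> \<open>Consistency is applied at \<open>?s\<close>: undoing the deviation restores
      \<open>s\<close>, whose price would then equal \<open>price ?s\<close>.\<close>
    then have "price (?s(j := s j)) = price ?s"
      using outcome_upd_above_price(1)[OF s' valid_reportsD[OF s], of j j] val truthful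
      by simp
    then show False using lower by simp
  qed
  ultimately show "price ?s = r" by simp
  then show "r < price s" "r < val M j"
    using lower val by simp_all
qed

section \<open>The invariant along the dynamic\<close>

text \<open>Buyers that have moved are recognised by an untruthful report. The bound
  \<open>price s \<le> s i\<close> is not strict because the latest mover reports the price itself;
  later steps strictly lower the price.\<close>

definition settled :: "('i \<Rightarrow> real) \<Rightarrow> bool" where
  "settled s \<longleftrightarrow> valid_reports s \<and>
     (\<forall>i. s i \<noteq> val M i \<longrightarrow> price s \<le> s i \<and> s i < val M i \<and> \<not> can_improve \<epsilon> A M s i)"

lemma earlier_deviator_cannot_improve:
  assumes s: "valid_reports s" and r: "r \<in> grid \<epsilon>" and truthful: "s j = val M j"
    and better: "payoff A M (s(j := r)) j > payoff A M s j"
    and "i \<noteq> j" and si: "price s \<le> s i" "s i < val M i"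
    and stuck: "\<not> can_improve \<epsilon> A M s i"
  shows "\<not> can_improve \<epsilon> A M (s(j := r)) i"
proof
  let ?s = "s(j := r)"
  have s': "valid_reports ?s" using s r by (rule valid_reports_upd)
  note dev = truthful_improvement[OF s r truthful better]
  have pay': "payoff A M ?s i = ereal (surplus M i r)"
    \<comment> \<open>Here \<open>r < price s \<le> s i < val M i\<close>, so \<open>i\<close> is
      hungry for report and value alike.\<close>
    using payoff_eq_surplus[OF s', of i, unfolded dev(1)] dev(2) si \<open>i \<noteq> j\<close> by simp
  have r_pos: "0 < r" using price_pos[OF s'] dev(1) by simp
  assume "can_improve \<epsilon> A M ?s i"
  then obtain q where q: "q \<in> grid \<epsilon>"
    and gain: "payoff A M (?s(i := q)) i > payoff A M ?s i"
    by (auto simp: can_improve_def)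
  let ?t = "?s(i := q)"
  have t: "valid_reports ?t" using s' q by (rule valid_reports_upd)
  have "surplus M i r < surplus M i (price ?t)"
    using order_less_le_trans[OF gain payoff_le_surplus[OF t]] pay' by simp
  then have below: "price ?t < r"
    using surplus_antimono[OF r_pos _ budget_pos, of "price ?t" i] by force
  \<comment> \<open>Restoring the report of \<open>j\<close> in \<open>?t\<close> gives a deviation
    that was already open to \<open>i\<close> at \<open>s\<close>.\<close>
  have eq: "?t(j := s j) = s(i := q)"
    using \<open>i \<noteq> j\<close> by auto
  have same: "price (s(i := q)) = price ?t" "alloc (s(i := q)) = alloc ?t"
    using outcome_upd_above_price[OF t valid_reportsD[OF s], of j j] below dev(3) truthful \<open>i \<noteq> j\<close>
    unfolding eq by simp_all
  have sq: "valid_reports (s(i := q))" using s q by (rule valid_reports_upd)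
  have "payoff A M ?t i = payoff A M (s(i := q)) i"
    unfolding payoff_eq[OF t] payoff_eq[OF sq] same ..
  also have "\<dots> \<le> payoff A M s i"
    using stuck q by (meson can_improve_def leI)
  also have "\<dots> \<le> ereal (surplus M i (price s))"
    by (rule payoff_le_surplus[OF s])
  also have "\<dots> \<le> payoff A M ?s i"
    unfolding pay' using surplus_antimono[OF r_pos _ budget_pos] dev(2) by simp
  finally show False using gain by simp
qed

lemma settled_step:
  assumes "settled s" "br_step \<epsilon> A M s s'"
  shows "settled s'" "card {i. s' i \<noteq> val M i} = Suc (card {i. s i \<noteq> val M i})"
proof -
  from assms(2) obtain j r where imp: "can_improve \<epsilon> A M s j"
    and br: "best_response \<epsilon> A M s j r" and s': "s' = s(j := r)"
    by (auto simp: br_step_def)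
  have s: "valid_reports s" using assms(1) by (simp add: settled_def)
  \<comment> \<open>In a settled profile untruthful buyers are stuck, so the mover is
    truthful.\<close>
  have truthful: "s j = val M j" using assms(1) imp by (auto simp: settled_def)
  have r: "r \<in> grid \<epsilon>" using br by (simp add: best_response_def)
  have better: "payoff A M (s(j := r)) j > payoff A M s j"
    using imp br unfolding can_improve_def best_response_def by (meson order_less_le_trans)
  note dev = truthful_improvement[OF s r truthful better]
  \<comment> \<open>Changing the report of \<open>j\<close> again leads to the same profiles as
    changing it in \<open>s\<close>, and \<open>r\<close> is already best among them.\<close>
  have "\<not> can_improve \<epsilon> A M s' j"
    using br by (auto simp: s' can_improve_def best_response_def not_less)
  moreover have "price s' \<le> s' i \<and> s' i < val M i \<and> \<not> can_improve \<epsilon> A M s' i"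
    if "i \<noteq> j" "s' i \<noteq> val M i" for i
  proof -
    have "price s \<le> s i" "s i < val M i" "\<not> can_improve \<epsilon> A M s i"
      using assms(1) that by (auto simp: settled_def s')
    then show ?thesis
      using earlier_deviator_cannot_improve[OF s r truthful better \<open>i \<noteq> j\<close>] dev that
      by (auto simp: s')
  qed
  ultimately show "settled s'"
    using valid_reports_upd[OF s r, of j] dev unfolding settled_def s'
    by (metis fun_upd_same order_refl)
  have "{i. s' i \<noteq> val M i} = insert j {i. s i \<noteq> val M i}"
    using dev(3) by (auto simp: s')
  then show "card {i. s' i \<noteq> val M i} = Suc (card {i. s i \<noteq> val M i})"
    using truthful by simp
qed

text \<open>Each step makes one truthful buyer untruthful for good, so counting steps counts
  distinct buyers.\<close>

lemma settled_steps:
  assumes "(br_step \<epsilon> A M ^^ k) (val M) s"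
  shows "settled s \<and> card {i. s i \<noteq> val M i} = k"
  using assms
proof (induction k arbitrary: s)
  case 0
  then show ?case using valid_val by (auto simp: settled_def)
next
  case (Suc k)
  then obtain t where t: "(br_step \<epsilon> A M ^^ k) (val M) t" "br_step \<epsilon> A M t s"
    by (blast elim: relpowp_Suc_E)
  have "settled t" "card {i. t i \<noteq> val M i} = k"
    using Suc.IH[OF t(1)] by simp_all
  then show ?case using settled_step[OF _ t(2)] by simp
qed

section \<open>Existence of best responses and convergence\<close>

text \<open>The grid is infinite, but a truthful buyer improves only with reports below its value,
  and these are finitely many.\<close>

lemma best_response_exists:
  assumes "settled s" "can_improve \<epsilon> A M s j"
  shows "\<exists>r. best_response \<epsilon> A M s j r"
proof -
  have s: "valid_reports s" using assms(1) by (simp add: settled_def)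
  have truthful: "s j = val M j" using assms by (auto simp: settled_def)
  define R where "R = {r \<in> grid \<epsilon>. payoff A M (s(j := r)) j > payoff A M s j}"
  have "R \<subseteq> {r \<in> grid \<epsilon>. r < val M j}"
    using truthful_improvement(3)[OF s _ truthful] by (auto simp: R_def)
  then have "finite R"
    using finite_grid_less[OF eps_pos] finite_subset by blast
  moreover have "R \<noteq> {}"
    using assms(2) by (auto simp: R_def can_improve_def)
  ultimately obtain r where r: "r \<in> R"
    and top: "payoff A M (s(j := r)) j = Max ((\<lambda>q. payoff A M (s(j := q)) j) ` R)"
    by (metis (no_types, lifting) Max_in finite_imageI image_iff image_is_empty)
  have max: "payoff A M (s(j := q)) j \<le> payoff A M (s(j := r)) j" if "q \<in> R" for q
    unfolding top using \<open>finite R\<close> that by simp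
  \<comment> \<open>Reports outside \<open>R\<close> do no better than the current one, which every
    member of \<open>R\<close> beats.\<close>
  have "payoff A M (s(j := q)) j \<le> payoff A M (s(j := r)) j" if "q \<in> grid \<epsilon>" for q
    using max[of q] r that by (force simp: R_def not_less)
  then show ?thesis
    using r by (auto simp: best_response_def R_def)
qed

lemma converges: "br_converges_within \<epsilon> A M (val M) CARD('i)"
  unfolding br_converges_within_def
proof (intro allI impI conjI)
  fix k s assume "(br_step \<epsilon> A M ^^ k) (val M) s"
  from settled_steps[OF this]
  have s: "settled s" and k: "card {i. s i \<noteq> val M i} = k" by auto
  show "k \<le> CARD('i)" unfolding k[symmetric] by (rule card_mono) auto
  show "pure_nash \<epsilon> A M s" if "\<nexists>s'. br_step \<epsilon> A M s s'"
  proof -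
    have "\<not> can_improve \<epsilon> A M s i" for i
      using that best_response_exists[OF s, of i] unfolding br_step_def by blast
    then show ?thesis
      using s by (simp add: pure_nash_def settled_def valid_reports_def)
  qed
qed

end

theorem theorem1p3:
  fixes \<epsilon> \<delta> :: real and A :: "'i::finite mechanism" and M :: "'i market"
  assumes "\<epsilon> > 0" and "\<delta> > 0"
    and "envy_free_mechanism \<epsilon> \<delta> A"
    and "consistent \<epsilon> A"
    and "is_market \<epsilon> M"
  shows "br_converges_within \<epsilon> A M (val M) CARD('i)"
proof -
  interpret consistent_market \<epsilon> \<delta> A M
    using assms by unfold_locales
  show ?thesis by (rule converges)
qed

end
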